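(* Let $\sigma:\Sigma\to\Sigma$ be a subshift of finite type. Suppose $\varphi\in C^0(\Sigma,\mathbb Q^n)$ is a locally constant function and $A\in C^0(\Sigma)$ is a Walters function. Let $r\in\varphi_*(\mathcal M_\sigma)\cap\mathbb Q^n$ and let $\nu\in\varphi_*^{-1}(r)$ be an ergodic probability measure in relation to which $\varphi$ is joint recurrent. Then for each $\epsilon>0$ there exists a periodic probability measure $\mu\in\varphi_*^{-1}(r)$ such that $\left|\int A\,d\nu-\int A\,d\mu\right|<\epsilon$.
   Context: $\Sigma$ is a one-sided subshift of finite type over a finite alphabet, with points $\mathbf x=(x_0,x_1,\dots)$ and shift map $\sigma$; it carries the metric $d(\mathbf x,\mathbf y)=\lambda^k$, $k=\min\{j:x_j\ne y_j\}$ (and $d(\mathbf x,\mathbf x)=0$), for a fixed $\lambda\in(0,1)$. $\mathcal M_\sigma$ is the set of $\sigma$-invariant Borel probability measures. For $\varphi=(\varphi_1,\dots,\varphi_n)\in C^0(\Sigma,\mathbb R^n)$ and $\mu\in\mathcal M_\sigma$, $\varphi_*(\mu)=\left(\int\varphi_1\,d\mu,\dots,\int\varphi_n\,d\mu\right)$, and $\varphi_*^{-1}(r)=\{\mu\in\mathcal M_\sigma:\varphi_*(\mu)=r\}$. $C^0(\Sigma,\mathbb Q^n)$ denotes the continuous functions $\Sigma\to\mathbb R^n$ with values in $\mathbb Q^n$. A continuous function $g$ on $\Sigma$ is locally constant if there is an integer $j\ge0$ such that $g(\mathbf x)=g(\mathbf y)$ whenever $x_0=y_0,\dots,x_j=y_j$.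 Put $S_kf=\sum_{j=0}^{k-1}f\circ\sigma^j$ and $d_k(\mathbf x,\mathbf y)=\max_{0\le j<k}d(\sigma^j\mathbf x,\sigma^j\mathbf y)$. A function $f\in C^0(\Sigma)$ is a Walters function (Walters potential) if there is an increasing function $H:\mathbb R^+\to\mathbb R^+\cup\{+\infty\}$, null and continuous at zero, such that for all $s\in\mathbb R^+$, $k>0$, $\mathbf x,\mathbf y\in\Sigma$: $d_k(\mathbf x,\mathbf y)\le s$ implies $|S_kf(\mathbf x)-S_kf(\mathbf y)|\le H(s)$. For a Borel set $D$ let $\Xi(D)$ be the set of $z\in D$ such that for every $\epsilon>0$ there is a positive integer $L$ with $\sigma^L(z)\in D$ and $\|S_L\varphi(z)-L\varphi_*(\nu)\|<\epsilon$. The function $\varphi$ is joint recurrent in relation to $\nu$ if $\nu(\Xi(D))=\nu(D)$ for every Borel set $D$. A periodic probability measure is a measure of the form $\frac1M\sum_{j=0}^{M-1}\delta_{\sigma^j(\mathbf x)}$ with $\mathbf x$ a periodic point of period $M$. *)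

theory Defs
  imports "HOL-Probability.Probability"
begin

definition shift :: "(nat \<Rightarrow> 'a) \<Rightarrow> nat \<Rightarrow> 'a" where
  "shift x = (\<lambda>i. x (Suc i))"

text \<open>The forbidden words may have arbitrary (bounded) length, so this covers in particular
  the subshifts given by a 0-1 transition matrix (forbidden words of length 2).\<close>

definition subshift_of_finite_type :: "(nat \<Rightarrow> 'a::finite) set \<Rightarrow> bool" where
  "subshift_of_finite_type X \<longleftrightarrow>
     (\<exists>F :: 'a list set. finite F \<and>
        X = {x. \<forall>w\<in>F. \<forall>i. map x [i..<i + length w] \<noteq> w})"

definition shift_dist :: "real \<Rightarrow> (nat \<Rightarrow> 'a) \<Rightarrow> (nat \<Rightarrow> 'a) \<Rightarrow> real" where
  "shift_dist l x y = (if x = y then 0 else l ^ (LEAST j. x j \<noteq> y j))"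

lemma Metric_space_shift_dist:
  assumes "0 < l" "l < 1"
  shows "Metric_space X (shift_dist l)"
proof
  fix x y :: "nat \<Rightarrow> 'a"
  show "0 \<le> shift_dist l x y"
    using assms by (simp add: shift_dist_def)
  show "shift_dist l x y = shift_dist l y x"
    by (simp add: shift_dist_def eq_commute)
  show "shift_dist l x y = 0 \<longleftrightarrow> x = y"
    using assms by (simp add: shift_dist_def)
next
  fix x y z :: "nat \<Rightarrow> 'a"
  let ?m = "\<lambda>x y :: nat \<Rightarrow> 'a. LEAST j. x j \<noteq> y j"
  show "shift_dist l x z \<le> shift_dist l x y + shift_dist l y z"
  proof (cases "x = y \<or> y = z \<or> x = z")
    case True
    then show ?thesis
      using assms by (auto simp: shift_dist_def)
  next
    case False
    then have "\<exists>j. x j \<noteq> z j"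
      by auto
    then have "x (?m x z) \<noteq> z (?m x z)"
      by (rule LeastI_ex)
    then have "x (?m x z) \<noteq> y (?m x z) \<or> y (?m x z) \<noteq> z (?m x z)"
      by auto
    then have "?m x y \<le> ?m x z \<or> ?m y z \<le> ?m x z"
      by (auto intro: Least_le)
    then have "l ^ ?m x z \<le> l ^ ?m x y \<or> l ^ ?m x z \<le> l ^ ?m y z"
      using assms by (auto intro: power_decreasing)
    moreover have "0 \<le> l ^ ?m x y" "0 \<le> l ^ ?m y z"
      using assms by auto
    ultimately have "l ^ ?m x z \<le> l ^ ?m x y + l ^ ?m y z"
      by linarith
    then show ?thesis
      using False by (simp add: shift_dist_def)
  qed
qed

definition shift_topology :: "real \<Rightarrow> (nat \<Rightarrow> 'a) set \<Rightarrow> (nat \<Rightarrow> 'a) topology" where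
  "shift_topology l X = Metric_space.mtopology X (shift_dist l)"

definition shift_borel :: "real \<Rightarrow> (nat \<Rightarrow> 'a) set \<Rightarrow> (nat \<Rightarrow> 'a) measure" where
  "shift_borel l X = sigma X {U. openin (shift_topology l X) U}"

definition invariant_measures :: "real \<Rightarrow> (nat \<Rightarrow> 'a) set \<Rightarrow> (nat \<Rightarrow> 'a) measure set" where
  "invariant_measures l X =
     {\<mu>. sets \<mu> = sets (shift_borel l X) \<and> prob_space \<mu> \<and>
          (\<forall>B\<in>sets \<mu>. emeasure \<mu> (shift -` B \<inter> X) = emeasure \<mu> B)}"

definition ergodic_measure :: "real \<Rightarrow> (nat \<Rightarrow> 'a) set \<Rightarrow> (nat \<Rightarrow> 'a) measure \<Rightarrow> bool" where
  "ergodic_measure l X \<mu> \<longleftrightarrow>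
     \<mu> \<in> invariant_measures l X \<and>
     (\<forall>B\<in>sets \<mu>. shift -` B \<inter> X = B \<longrightarrow> emeasure \<mu> B = 0 \<or> emeasure \<mu> B = 1)"

definition rotation_vector ::
    "((nat \<Rightarrow> 'a) \<Rightarrow> real ^ 'n) \<Rightarrow> (nat \<Rightarrow> 'a) measure \<Rightarrow> real ^ 'n" where
  "rotation_vector \<phi> \<mu> = (\<chi> i. integral\<^sup>L \<mu> (\<lambda>x. \<phi> x $ i))"

definition rotation_fiber ::
    "real \<Rightarrow> (nat \<Rightarrow> 'a) set \<Rightarrow> ((nat \<Rightarrow> 'a) \<Rightarrow> real ^ 'n) \<Rightarrow> real ^ 'n \<Rightarrow> (nat \<Rightarrow> 'a) measure set" where
  "rotation_fiber l X \<phi> r = {\<mu> \<in> invariant_measures l X. rotation_vector \<phi> \<mu> = r}"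

definition rational_vectors :: "(real ^ 'n) set" where
  "rational_vectors = {v. \<forall>i. v $ i \<in> \<rat>}"

definition locally_constant :: "(nat \<Rightarrow> 'a) set \<Rightarrow> ((nat \<Rightarrow> 'a) \<Rightarrow> 'b) \<Rightarrow> bool" where
  "locally_constant X g \<longleftrightarrow>
     (\<exists>j. \<forall>x\<in>X. \<forall>y\<in>X. (\<forall>i\<le>j. x i = y i) \<longrightarrow> g x = g y)"

definition birkhoff_sum ::
    "nat \<Rightarrow> ((nat \<Rightarrow> 'a) \<Rightarrow> 'b) \<Rightarrow> (nat \<Rightarrow> 'a) \<Rightarrow> 'b::comm_monoid_add" where
  "birkhoff_sum k f x = (\<Sum>j<k. f ((shift ^^ j) x))"

definition bowen_dist :: "real \<Rightarrow> nat \<Rightarrow> (nat \<Rightarrow> 'a) \<Rightarrow> (nat \<Rightarrow> 'a) \<Rightarrow> real" where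
  "bowen_dist l k x y = Max ((\<lambda>j. shift_dist l ((shift ^^ j) x) ((shift ^^ j) y)) ` {..<k})"

text \<open>The modulus \<open>H\<close> takes values in the extended half-line; only its values
  on \<open>[0, \<infinity>)\<close> matter, and \<open>increasing\<close> is read in the weak sense.\<close>

definition walters_function ::
    "real \<Rightarrow> (nat \<Rightarrow> 'a) set \<Rightarrow> ((nat \<Rightarrow> 'a) \<Rightarrow> real) \<Rightarrow> bool" where
  "walters_function l X f \<longleftrightarrow>
     continuous_map (shift_topology l X) euclideanreal f \<and>
     (\<exists>H :: real \<Rightarrow> ennreal.
        mono_on {0..} H \<and> H 0 = 0 \<and> continuous (at 0 within {0..}) H \<and>
        (\<forall>s\<ge>0. \<forall>k>0. \<forall>x\<in>X. \<forall>y\<in>X. bowen_dist l k x y \<le> s \<longrightarrow>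
           ennreal \<bar>birkhoff_sum k f x - birkhoff_sum k f y\<bar> \<le> H s))"

definition joint_recurrence_set ::
    "((nat \<Rightarrow> 'a) \<Rightarrow> real ^ 'n) \<Rightarrow> (nat \<Rightarrow> 'a) measure \<Rightarrow> (nat \<Rightarrow> 'a) set \<Rightarrow> (nat \<Rightarrow> 'a) set" where
  "joint_recurrence_set \<phi> \<nu> D =
     {z \<in> D. \<forall>\<epsilon>>0. \<exists>L>0. (shift ^^ L) z \<in> D \<and>
        norm (birkhoff_sum L \<phi> z - real L *\<^sub>R rotation_vector \<phi> \<nu>) < \<epsilon>}"

definition joint_recurrent ::
    "((nat \<Rightarrow> 'a) \<Rightarrow> real ^ 'n) \<Rightarrow> (nat \<Rightarrow> 'a) measure \<Rightarrow> bool" where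
  "joint_recurrent \<phi> \<nu> \<longleftrightarrow>
     (\<forall>D\<in>sets \<nu>. emeasure \<nu> (joint_recurrence_set \<phi> \<nu> D) = emeasure \<nu> D)"

text \<open>\<open>M\<close> is a period of \<open>x\<close>, not necessarily the least one; passing to
  the least period gives the same measure.\<close>

definition periodic_measure :: "real \<Rightarrow> (nat \<Rightarrow> 'a) set \<Rightarrow> (nat \<Rightarrow> 'a) measure \<Rightarrow> bool" where
  "periodic_measure l X \<mu> \<longleftrightarrow>
     sets \<mu> = sets (shift_borel l X) \<and>
     (\<exists>x\<in>X. \<exists>M>0. (shift ^^ M) x = x \<and>
        (\<forall>B\<in>sets \<mu>. emeasure \<mu> B =
           ennreal (1 / real M) *
             (\<Sum>j<M. emeasure (return (shift_borel l X) ((shift ^^ j) x)) B)))"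

end

theory Submission
  imports Defs
begin

text \<open>
  The periodic measure sits on the orbit obtained by repeating a finite piece
  \<open>z\<^sub>0 \<dots> z\<^bsub>L-1\<^esub>\<close> of a \<open>\<nu>\<close>-typical point \<open>z\<close>, where the time \<open>L\<close> has to meet three demands.

  Firstly, the Birkhoff sum of \<open>\<phi>\<close> up to time \<open>L\<close> must be exactly \<open>L r\<close>. This is where rationality enters:
  a locally constant function on a shift over a finite alphabet has finitely many values, so \<open>r\<close>
  and all values of \<open>\<phi>\<close> have a common denominator \<open>q\<close>, the difference \<open>S\<^sub>L\<phi>(z) - L r\<close> lies in the
  lattice \<open>(1/q) \<int>\<^sup>n\<close>, and it vanishes as soon as its norm is below \<open>1/q\<close>. Joint recurrence thus
  provides exact returns. Secondly, \<open>z\<close> must return at time \<open>L\<close> to its own cylinder of some large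
  length \<open>N\<close>. Then the periodic repetition of \<open>z\<^sub>0 \<dots> z\<^bsub>L-1\<^esub>\<close> agrees with \<open>z\<close> on the first
  \<open>N + L\<close> symbols, so it contains no forbidden word (\<open>subshift_closing\<close>), has the same sum of
  \<open>\<phi>\<close>, and by the Walters property its sum of \<open>A\<close> is within a bound independent of \<open>L\<close>.
  Thirdly, \<open>S\<^sub>LA(z) / L\<close> must be close to the integral of \<open>A\<close>; since \<open>z\<close> is typical for the ergodic theorem
  (\<open>AE_orbit_sums_linear\<close>), this holds once \<open>L\<close> is large.

  Joint recurrence by itself promises just one positive return time. That there are arbitrarily large
  ones (\<open>AE_infinitely_many_exact_returns\<close>) follows by applying it to the set of points whose last exact
  return happens at a given time: a point of this set that returned exactly to the set would have a
  later exact return.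
\<close>

section \<open>The one-sided ergodic theorem\<close>

text \<open>The maximum of the orbit sums of \<open>f\<close> over the times \<open>0, \<dots>, n\<close>. The recursion is the form in which
  the maximal function interacts with \<open>T\<close>.\<close>

primrec running_max :: "('a \<Rightarrow> 'a) \<Rightarrow> ('a \<Rightarrow> real) \<Rightarrow> nat \<Rightarrow> 'a \<Rightarrow> real" where
  "running_max T f 0 x = 0"
| "running_max T f (Suc n) x = max 0 (f x + running_max T f n (T x))"

lemma running_max_nonneg: "0 \<le> running_max T f n x"
  by (cases n) auto

lemma running_max_mono:
  assumes "n \<le> m"
  shows "running_max T f n x \<le> running_max T f m x"
proof -
  have "running_max T f n x \<le> running_max T f (Suc n) x" for n
  proof (induction n arbitrary: x)
    case (Suc n)
    show ?case using Suc[of "T x"] by auto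
  qed simp
  then show ?thesis
    by (rule lift_Suc_mono_le) fact
qed

lemma sum_orbit_Suc:
  fixes f :: "'a \<Rightarrow> 'b::comm_monoid_add"
  shows "(\<Sum>j<Suc n. f ((T ^^ j) x)) = f x + (\<Sum>j<n. f ((T ^^ j) (T x)))"
  by (simp only: sum.lessThan_Suc_shift funpow_Suc_right o_def funpow_0)

lemma sum_orbit_le_running_max: "(\<Sum>j<n. f ((T ^^ j) x)) \<le> running_max T f n x"
proof (induction n arbitrary: x)
  case (Suc n)
  show ?case using Suc[of "T x"] unfolding sum_orbit_Suc by auto
qed simp

text \<open>The set \<open>B\<close> where the orbit sums are unbounded above is invariant, so it is null unless it has
  full measure. In the latter case let \<open>R\<^sub>n\<close> be the running maximum. The increments
  \<open>R\<^bsub>n+1\<^esub> - R\<^sub>n \<circ> T = max (- (R\<^sub>n \<circ> T)) f\<close> are dominated by \<open>\<bar>f\<bar>\<close> and converge to \<open>f\<close>, as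
  \<open>R\<^sub>n\<close> tends to infinity on \<open>B\<close>; by invariance of the measure their integrals are those of
  \<open>R\<^bsub>n+1\<^esub> - R\<^sub>n \<ge> 0\<close>. Hence \<open>f\<close> would have a nonnegative integral.\<close>

theorem AE_orbit_sums_bounded_above:
  fixes f :: "'a \<Rightarrow> real"
  assumes "prob_space M" and T[measurable]: "T \<in> measurable M M"
    and inv: "\<And>B. B \<in> sets M \<Longrightarrow> emeasure M (T -` B \<inter> space M) = emeasure M B"
    and erg: "\<And>B. B \<in> sets M \<Longrightarrow> T -` B \<inter> space M = B \<Longrightarrow> emeasure M B = 0 \<or> emeasure M B = 1"
    and f: "integrable M f" and neg: "integral\<^sup>L M f < 0"
  shows "AE x in M. \<exists>C. \<forall>n. (\<Sum>j<n. f ((T ^^ j) x)) \<le> C"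
proof -
  interpret prob_space M by fact
  let ?S = "\<lambda>n x. \<Sum>j<n. f ((T ^^ j) x)"
  let ?R = "running_max T f"
  have [measurable]: "f \<in> borel_measurable M" using f by auto
  have [measurable]: "(\<lambda>x. (T ^^ j) x) \<in> measurable M M" for j
    by (intro measurable_compose_n T)
  define B where "B = {x \<in> space M. \<forall>c::nat. \<exists>n. real c < ?S n x}"
  have Bsets: "B \<in> sets M" unfolding B_def by measurable
  have distr: "distr M M T = M"
    by (rule measure_eqI) (auto simp: emeasure_distr inv)
  have int_T: "integrable M (\<lambda>x. g (T x))" "integral\<^sup>L M (\<lambda>x. g (T x)) = integral\<^sup>L M g"
    if "integrable M g" for g :: "'a \<Rightarrow> real"
    using integrable_distr[OF T, of g] integral_distr[OF T, of g] that
    by (auto simp: distr)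
  have R_int: "integrable M (?R n)" for n
  proof (induction n)
    case (Suc n)
    have "integrable M (\<lambda>x. max 0 (f x + ?R n (T x)))"
      using f int_T(1)[OF Suc] by auto
    then show ?case by (simp add: fun_eq_iff[symmetric] cong: integrable_cong)
  qed simp
  have unbounded_T: "x \<in> B \<longleftrightarrow> T x \<in> B" if x: "x \<in> space M" for x
  proof
    assume "x \<in> B"
    have "\<exists>n. real c < ?S n (T x)" for c :: nat
    proof -
      obtain d :: nat where d: "\<bar>f x\<bar> + real c \<le> real d" using real_arch_simple by blast
      obtain n where n: "real d < ?S n x" using \<open>x \<in> B\<close> unfolding B_def by blast
      then obtain m where "n = Suc m" using d by (cases n) auto
      then have "?S n x = f x + ?S m (T x)" by (simp only: sum_orbit_Suc)
      then show ?thesis using n d by (intro exI[of _ m]) linarith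
    qed
    then show "T x \<in> B" unfolding B_def using x measurable_space[OF T x] by auto
  next
    assume "T x \<in> B"
    have "\<exists>n. real c < ?S n x" for c :: nat
    proof -
      obtain d :: nat where d: "\<bar>f x\<bar> + real c \<le> real d" using real_arch_simple by blast
      obtain n where n: "real d < ?S n (T x)" using \<open>T x \<in> B\<close> unfolding B_def by blast
      show ?thesis using n d sum_orbit_Suc[where f = f and T = T and n = n and x = x] by (intro exI[of _ "Suc n"]) linarith
    qed
    then show "x \<in> B" unfolding B_def using x by auto
  qed
  have "T -` B \<inter> space M = B" using unbounded_T sets.sets_into_space[OF Bsets] by auto
  then have "emeasure M B = 0 \<or> emeasure M B = 1" using erg Bsets by auto
  moreover have "emeasure M B \<noteq> 1"
  proof
    assume "emeasure M B = 1"
    then have AE_B: "AE x in M. x \<in> B" using Bsets by (simp add: AE_in_set_eq_1 measure_def)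
    let ?g = "\<lambda>n x. ?R (Suc n) x - ?R n (T x)"
    have g: "?g n x = max (- ?R n (T x)) (f x)" for n x by auto
    have ev: "\<forall>\<^sub>F n in sequentially. ?g n x = f x" if "x \<in> B" for x
    proof -
      have "T x \<in> B" using that unbounded_T unfolding B_def by blast
      obtain d :: nat where d: "\<bar>f x\<bar> \<le> real d" using real_arch_simple by blast
      obtain n where n: "real d < ?S n (T x)" using \<open>T x \<in> B\<close> unfolding B_def by blast
      have "?g m x = f x" if "m \<ge> n" for m
        using sum_orbit_le_running_max[where n=n and T=T and f=f and x="T x"] n d running_max_mono[OF that, of T f "T x"]
        unfolding g by linarith
      then show ?thesis unfolding eventually_sequentially by blast
    qed
    have "(\<lambda>n. integral\<^sup>L M (?g n)) \<longlonglongrightarrow> integral\<^sup>L M f"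
    proof (rule integral_dominated_convergence)
      show "integrable M (\<lambda>x. \<bar>f x\<bar>)" using f by auto
      show "?g n \<in> borel_measurable M" for n
        using R_int[of "Suc n"] int_T(1)[OF R_int[of n]] by (intro borel_measurable_diff) auto
      show "AE x in M. (\<lambda>n. ?g n x) \<longlonglongrightarrow> f x"
        using AE_B by eventually_elim (use ev in \<open>auto intro: tendsto_eventually\<close>)
      show "AE x in M. norm (?g n x) \<le> \<bar>f x\<bar>" for n
        using running_max_nonneg[of T f n] unfolding g by (intro AE_I2) (smt (verit) real_norm_def)
    qed auto
    moreover have "0 \<le> integral\<^sup>L M (?g n)" for n
    proof -
      have "integral\<^sup>L M (?g n) = integral\<^sup>L M (?R (Suc n)) - integral\<^sup>L M (?R n)"
        using R_int int_T[OF R_int] by (subst Bochner_Integration.integral_diff) auto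
      also have "\<dots> \<ge> 0"
        using integral_mono[OF R_int R_int, of n "Suc n"] running_max_mono[of n "Suc n" T f]
        by auto
      finally show ?thesis .
    qed
    ultimately have "0 \<le> integral\<^sup>L M f"
      using LIMSEQ_le_const by blast
    then show False using neg by simp
  qed
  ultimately have "AE x in M. x \<notin> B" using Bsets by (intro AE_not_in) (auto simp: null_sets_def)
  then show ?thesis
  proof (rule AE_mp, intro AE_I2 impI)
    fix x assume "x \<in> space M" "x \<notin> B"
    then obtain c :: nat where "\<forall>n. \<not> real c < ?S n x" unfolding B_def by blast
    then show "\<exists>C. \<forall>n. ?S n x \<le> C" by (intro exI[of _ "real c"]) (simp add: not_less)
  qed
qed

text \<open>The part of Birkhoff's theorem that the approximation needs, obtained from the previous bound for
  \<open>f - (\<integral>f + \<delta>)\<close> and \<open>(\<integral>f - \<delta>) - f\<close>, both of which have integral \<open>- \<delta>\<close>.\<close>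

corollary AE_orbit_sums_linear:
  fixes f :: "'a \<Rightarrow> real"
  assumes "prob_space M" and T: "T \<in> measurable M M"
    and inv: "\<And>B. B \<in> sets M \<Longrightarrow> emeasure M (T -` B \<inter> space M) = emeasure M B"
    and erg: "\<And>B. B \<in> sets M \<Longrightarrow> T -` B \<inter> space M = B \<Longrightarrow> emeasure M B = 0 \<or> emeasure M B = 1"
    and f: "integrable M f" and "0 < \<delta>"
  shows "AE x in M. \<exists>C. \<forall>n. \<bar>(\<Sum>j<n. f ((T ^^ j) x)) - real n * integral\<^sup>L M f\<bar> \<le> real n * \<delta> + C"
proof -
  interpret prob_space M by fact
  let ?a = "integral\<^sup>L M f"
  have "AE x in M. \<exists>C. \<forall>n. (\<Sum>j<n. f ((T ^^ j) x) - (?a + \<delta>)) \<le> C"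
    using f \<open>0 < \<delta>\<close>
    by (intro AE_orbit_sums_bounded_above[OF assms(1) T inv erg]) (auto simp: prob_space)
  moreover have "AE x in M. \<exists>C. \<forall>n. (\<Sum>j<n. (?a - \<delta>) - f ((T ^^ j) x)) \<le> C"
    using f \<open>0 < \<delta>\<close>
    by (intro AE_orbit_sums_bounded_above[OF assms(1) T inv erg]) (auto simp: prob_space)
  ultimately show ?thesis
  proof eventually_elim
    case (elim x)
    then obtain C D where C: "\<forall>n. (\<Sum>j<n. f ((T ^^ j) x) - (?a + \<delta>)) \<le> C"
      and D: "\<forall>n. (\<Sum>j<n. (?a - \<delta>) - f ((T ^^ j) x)) \<le> D" by blast
    have "\<bar>(\<Sum>j<n. f ((T ^^ j) x)) - real n * ?a\<bar> \<le> real n * \<delta> + max C D" for n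
      using C[rule_format, of n] D[rule_format, of n]
      by (simp add: sum_subtractf sum.distrib algebra_simps abs_le_iff max_def)
    then show ?case by blast
  qed
qed

section \<open>The Borel structure of a shift space\<close>

lemma funpow_shift: "(shift ^^ j) x = (\<lambda>i. x (i + j))"
  by (induction j arbitrary: x) (auto simp: shift_def)

lemma shift_dist_le_power_iff:
  assumes "0 < l" "l < 1"
  shows "shift_dist l x y \<le> l ^ n \<longleftrightarrow> (\<forall>i<n. x i = y i)"
proof (cases "x = y")
  case True
  then show ?thesis using assms by (simp add: shift_dist_def)
next
  case False
  let ?k = "LEAST j. x j \<noteq> y j"
  have "\<exists>j. x j \<noteq> y j" using False by auto
  then have k: "x ?k \<noteq> y ?k" by (rule LeastI_ex)
  have "shift_dist l x y \<le> l ^ n \<longleftrightarrow> n \<le> ?k"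
    using assms False by (simp add: shift_dist_def power_decreasing_iff)
  also have "\<dots> \<longleftrightarrow> (\<forall>i<n. x i = y i)"
    using k not_less_Least[of _ "\<lambda>j. x j \<noteq> y j"] by (meson leI less_le_trans)
  finally show ?thesis .
qed

lemma openin_shift_topology_iff:
  assumes "0 < l" "l < 1"
  shows "openin (shift_topology l X) U \<longleftrightarrow>
    U \<subseteq> X \<and> (\<forall>x\<in>U. \<exists>n. \<forall>y\<in>X. (\<forall>i<n. x i = y i) \<longrightarrow> y \<in> U)"
proof -
  interpret Metric_space X "shift_dist l" by (rule Metric_space_shift_dist[OF assms])
  have "(\<exists>r>0. mball x r \<subseteq> U) \<longleftrightarrow> (\<exists>n. \<forall>y\<in>X. (\<forall>i<n. x i = y i) \<longrightarrow> y \<in> U)"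
    if "x \<in> U" "U \<subseteq> X" for x
  proof
    assume "\<exists>r>0. mball x r \<subseteq> U"
    then obtain r where r: "r > 0" "mball x r \<subseteq> U" by blast
    obtain n where n: "l ^ n < r" using real_arch_pow_inv[OF r(1) assms(2)] by blast
    have "y \<in> U" if "y \<in> X" "\<forall>i<n. x i = y i" for y
    proof -
      have "shift_dist l x y \<le> l ^ n" using that shift_dist_le_power_iff[OF assms] by blast
      then have "y \<in> mball x r" using n that \<open>x \<in> U\<close> \<open>U \<subseteq> X\<close> by (simp add: subset_iff)
      then show ?thesis using r(2) by blast
    qed
    then show "\<exists>n. \<forall>y\<in>X. (\<forall>i<n. x i = y i) \<longrightarrow> y \<in> U" by blast
  next
    assume "\<exists>n. \<forall>y\<in>X. (\<forall>i<n. x i = y i) \<longrightarrow> y \<in> U"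
    then obtain n where n: "\<forall>y\<in>X. (\<forall>i<n. x i = y i) \<longrightarrow> y \<in> U" by blast
    have "mball x (l ^ n) \<subseteq> U"
    proof
      fix y assume "y \<in> mball x (l ^ n)"
      then have "y \<in> X" "shift_dist l x y \<le> l ^ n" by auto
      then show "y \<in> U" using n shift_dist_le_power_iff[OF assms] by blast
    qed
    then show "\<exists>r>0. mball x r \<subseteq> U" using assms by (intro exI[of _ "l ^ n"]) auto
  qed
  then show ?thesis unfolding shift_topology_def openin_mtopology by blast
qed

lemma topspace_shift_topology: "0 < l \<Longrightarrow> l < 1 \<Longrightarrow> topspace (shift_topology l X) = X"
  by (simp add: shift_topology_def Metric_space.topspace_mtopology[OF Metric_space_shift_dist])

lemma space_shift_borel: "space (shift_borel l X) = X"
  by (simp add: shift_borel_def space_measure_of_conv)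

lemma sets_shift_borel:
  assumes "0 < l" "l < 1"
  shows "sets (shift_borel l X) = sigma_sets X {U. openin (shift_topology l X) U}"
  unfolding shift_borel_def
  using openin_subset[of "shift_topology l X"] topspace_shift_topology[OF assms, of X]
  by (intro sets_measure_of) auto

lemma shift_measurable:
  assumes "0 < l" "l < 1" and inv: "\<And>x. x \<in> X \<Longrightarrow> shift x \<in> X"
  shows "shift \<in> measurable (shift_borel l X) (shift_borel l X)"
proof (rule measurable_sigma_sets[OF sets_shift_borel[OF assms(1,2)]])
  show "{U. openin (shift_topology l X) U} \<subseteq> Pow X"
    using openin_shift_topology_iff[OF assms(1,2), of X] by auto
  show "shift \<in> space (shift_borel l X) \<rightarrow> X" using inv by (auto simp: space_shift_borel)
  fix U assume "U \<in> {U. openin (shift_topology l X) U}"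
  then have U: "U \<subseteq> X" "\<And>x. x \<in> U \<Longrightarrow> \<exists>n. \<forall>y\<in>X. (\<forall>i<n. x i = y i) \<longrightarrow> y \<in> U"
    by (auto simp: openin_shift_topology_iff[OF assms(1,2)])
  have "\<exists>n. \<forall>y\<in>X. (\<forall>i<n. x i = y i) \<longrightarrow> y \<in> shift -` U \<inter> X" if x: "x \<in> shift -` U \<inter> X" for x
  proof -
    obtain n where n: "\<forall>y\<in>X. (\<forall>i<n. shift x i = y i) \<longrightarrow> y \<in> U" using U(2) x by blast
    have "y \<in> shift -` U \<inter> X" if "y \<in> X" "\<forall>i<Suc n. x i = y i" for y
      using n inv[OF that(1)] that by (auto simp: shift_def)
    then show ?thesis by blast
  qed
  then have "openin (shift_topology l X) (shift -` U \<inter> X)"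
    by (auto simp: openin_shift_topology_iff[OF assms(1,2)])
  then show "shift -` U \<inter> space (shift_borel l X) \<in> sets (shift_borel l X)"
    by (auto simp: sets_shift_borel[OF assms(1,2)] space_shift_borel)
qed

lemma continuous_map_borel_measurable:
  assumes "0 < l" "l < 1" "continuous_map (shift_topology l X) euclidean f"
  shows "f \<in> borel_measurable (shift_borel l X)"
proof (rule borel_measurableI)
  fix S :: "'b set" assume "open S"
  then have "openin (shift_topology l X) {x \<in> topspace (shift_topology l X). f x \<in> S}"
    by (intro openin_continuous_map_preimage[OF assms(3)]) simp
  moreover have "{x \<in> topspace (shift_topology l X). f x \<in> S} = f -` S \<inter> X"
    using topspace_shift_topology[OF assms(1,2)] by auto
  ultimately show "f -` S \<inter> space (shift_borel l X) \<in> sets (shift_borel l X)"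
    by (auto simp: sets_shift_borel[OF assms(1,2)] space_shift_borel)
qed

lemma cylinder_in_sets:
  assumes "0 < l" "l < 1"
  shows "{x \<in> X. map x [0..<N] = w} \<in> sets (shift_borel l X)"
proof -
  have "openin (shift_topology l X) {x \<in> X. map x [0..<N] = w}"
    unfolding openin_shift_topology_iff[OF assms] by (auto intro!: exI[of _ N])
  then show ?thesis by (auto simp: sets_shift_borel[OF assms])
qed

text \<open>There are finitely many words of length \<open>N\<close> over a finite alphabet.\<close>

lemma finite_range_of_prefix:
  fixes g :: "(nat \<Rightarrow> 'a::finite) \<Rightarrow> 'b"
  assumes "\<And>x y. x \<in> X \<Longrightarrow> y \<in> X \<Longrightarrow> \<forall>i<N. x i = y i \<Longrightarrow> g x = g y"
  shows "finite (g ` X)"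
proof -
  let ?p = "\<lambda>x :: nat \<Rightarrow> 'a. map x [0..<N]"
  have "finite (?p ` X)"
    by (rule finite_subset[OF _ finite_lists_length_eq[of UNIV N]]) auto
  moreover have "g ` X \<subseteq> (\<lambda>w. g (SOME y. y \<in> X \<and> ?p y = w)) ` ?p ` X"
  proof
    fix v assume "v \<in> g ` X"
    then obtain x where x: "x \<in> X" "v = g x" by blast
    let ?y = "SOME y. y \<in> X \<and> ?p y = ?p x"
    have "?y \<in> X \<and> ?p ?y = ?p x" by (rule someI[of _ x]) (use x in auto)
    then have "g ?y = v" using assms[of ?y x] x by (auto simp: map_eq_conv)
    then show "v \<in> (\<lambda>w. g (SOME y. y \<in> X \<and> ?p y = w)) ` ?p ` X" using x by blast
  qed
  ultimately show ?thesis by (meson finite_imageI finite_subset)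
qed

section \<open>Walters functions\<close>

text \<open>If two points agree on \<open>N + k\<close> symbols, then their first \<open>k\<close> shifts agree on \<open>N\<close> symbols each, so
  the Bowen distance is at most \<open>l ^ N\<close>. The bound on the sums therefore does not degrade with
  \<open>k\<close>.\<close>

lemma walters_function_small:
  assumes "0 < l" "l < 1" "walters_function l X f" "0 < e"
  obtains N0 where "\<And>N k x y. N0 \<le> N \<Longrightarrow> 0 < k \<Longrightarrow> x \<in> X \<Longrightarrow> y \<in> X \<Longrightarrow> \<forall>i<N + k. x i = y i \<Longrightarrow>
    \<bar>birkhoff_sum k f x - birkhoff_sum k f y\<bar> < e"
proof -
  obtain H :: "real \<Rightarrow> ennreal" where H: "H 0 = 0" "continuous (at 0 within {0..}) H"
    and H_bound: "\<forall>s\<ge>0. \<forall>k>0. \<forall>x\<in>X. \<forall>y\<in>X. bowen_dist l k x y \<le> s \<longrightarrow>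
       ennreal \<bar>birkhoff_sum k f x - birkhoff_sum k f y\<bar> \<le> H s"
    using assms(3) unfolding walters_function_def by (elim conjE exE)
  have "(\<lambda>N. l ^ N) \<longlonglongrightarrow> 0" using assms by (intro LIMSEQ_power_zero) auto
  then have "filterlim (\<lambda>N. l ^ N) (at 0 within {0..}) sequentially"
    using assms by (auto simp: filterlim_at intro!: always_eventually)
  with H(2) have "(\<lambda>N. H (l ^ N)) \<longlonglongrightarrow> H 0"
    unfolding continuous_within by (rule filterlim_compose)
  then have "\<forall>\<^sub>F N in sequentially. H (l ^ N) < ennreal e"
    by (rule order_tendstoD) (simp add: H(1) assms)
  then obtain N0 where N0: "\<And>N. N \<ge> N0 \<Longrightarrow> H (l ^ N) < ennreal e"
    unfolding eventually_sequentially by blast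
  have "\<bar>birkhoff_sum k f x - birkhoff_sum k f y\<bar> < e"
    if "N \<ge> N0" "k > 0" "x \<in> X" "y \<in> X" "\<forall>i<N + k. x i = y i" for N k x y
  proof -
    have "bowen_dist l k x y \<le> l ^ N"
      unfolding bowen_dist_def using that
      by (subst Max_le_iff) (auto simp: funpow_shift shift_dist_le_power_iff[OF assms(1,2)])
    then have "ennreal \<bar>birkhoff_sum k f x - birkhoff_sum k f y\<bar> \<le> H (l ^ N)"
      using H_bound that assms(1) by simp
    also have "\<dots> < ennreal e" using N0 that by auto
    finally show ?thesis by (simp add: ennreal_less_iff)
  qed
  then show thesis by (rule that)
qed

text \<open>For \<open>k = 1\<close> the previous lemma makes \<open>f\<close> vary by less than 1 on the cylinders of a fixed length, of
  which there are finitely many. The map \<open>?rep\<close> in the proof selects one point from each.\<close>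

lemma walters_function_bounded:
  fixes X :: "(nat \<Rightarrow> 'a::finite) set"
  assumes "0 < l" "l < 1" "walters_function l X f"
  shows "\<exists>K. \<forall>x\<in>X. \<bar>f x\<bar> \<le> K"
proof -
  obtain N where N0: "\<And>M k x y. N \<le> M \<Longrightarrow> 0 < k \<Longrightarrow> x \<in> X \<Longrightarrow> y \<in> X \<Longrightarrow>
      \<forall>i<M + k. x i = y i \<Longrightarrow> \<bar>birkhoff_sum k f x - birkhoff_sum k f y\<bar> < 1"
    by (rule walters_function_small[OF assms, of 1]) auto
  have N: "\<bar>f x - f y\<bar> < 1" if "x \<in> X" "y \<in> X" "\<forall>i<N + 1. x i = y i" for x y
    using N0[of N 1 x y] that by (simp add: birkhoff_sum_def)
  let ?rep = "\<lambda>x. SOME y. y \<in> X \<and> (\<forall>i<N + 1. x i = y i)"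
  have rep: "?rep x \<in> X \<and> (\<forall>i<N + 1. x i = ?rep x i)" if "x \<in> X" for x
    by (rule someI[of _ x]) (use that in auto)
  have "finite ((\<lambda>x. \<bar>f (?rep x)\<bar>) ` X)"
  proof (rule finite_range_of_prefix[where N = "N + 1"])
    fix x y :: "nat \<Rightarrow> 'a" assume "\<forall>i<N + 1. x i = y i"
    then have "(\<forall>i<N + 1. x i = w i) \<longleftrightarrow> (\<forall>i<N + 1. y i = w i)" for w by auto
    then show "\<bar>f (?rep x)\<bar> = \<bar>f (?rep y)\<bar>" by presburger
  qed
  then obtain K where K: "\<And>x. x \<in> X \<Longrightarrow> \<bar>f (?rep x)\<bar> \<le> K"
    using bdd_above_finite unfolding bdd_above_def by fastforce
  have "\<bar>f x\<bar> \<le> K + 1" if "x \<in> X" for x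
    using N[of x "?rep x"] rep[OF that] K[OF that] that by force
  then show ?thesis by blast
qed

section \<open>Exact recurrence\<close>

lemma common_denominator:
  fixes F :: "real set"
  assumes "finite F" "F \<subseteq> \<rat>"
  shows "\<exists>q::nat. q > 0 \<and> (\<forall>x\<in>F. real q * x \<in> \<int>)"
  using assms
proof (induction F)
  case empty
  show ?case by (auto intro: exI[of _ 1])
next
  case (insert x F)
  then obtain q :: nat where q: "q > 0" "\<forall>y\<in>F. real q * y \<in> \<int>" by auto
  obtain a :: int and b :: nat where ab: "b \<noteq> 0" "x = real_of_int a / real b"
    using insert.prems by (auto simp: Rats_eq_int_div_nat)
  have "real (q * b) * y \<in> \<int>" if "y \<in> insert x F" for y
  proof (cases "y = x")
    case True
    then have "real (q * b) * y = of_int (int q * a)" using ab by simp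
    then show ?thesis by (metis Ints_of_int)
  next
    case False
    then have "real q * y \<in> \<int>" using q that by blast
    then have "real b * (real q * y) \<in> \<int>" by (rule Ints_mult[OF Ints_of_nat])
    then show ?thesis by (simp add: mult_ac)
  qed
  then show ?case using q ab by (intro exI[of _ "q * b"]) auto
qed

lemma birkhoff_sum_add:
  "birkhoff_sum (m + n) f x = birkhoff_sum m f x + birkhoff_sum n f ((shift ^^ m) x)"
proof (induction n)
  case (Suc n)
  have "(shift ^^ (m + n)) x = (shift ^^ n) ((shift ^^ m) x)"
    by (metis add.commute comp_apply funpow_add)
  then show ?case using Suc by (simp add: birkhoff_sum_def add.assoc)
qed (simp add: birkhoff_sum_def)

text \<open>The set \<open>E M\<close> in the proof consists of the points whose last exact return to \<open>D\<close> is at time \<open>M\<close>,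
  where \<open>M = 0\<close> stands for the points without an exact return. Composing an exact return from
  \<open>E M\<close> to itself at time \<open>L > 0\<close> with the return at time \<open>M\<close> gives an exact return at time \<open>L + M > M\<close>,
  a contradiction; so the recurrence set of \<open>E M\<close> is empty, and \<open>E M\<close> is null by joint recurrence.\<close>

lemma AE_infinitely_many_exact_returns:
  fixes \<phi> :: "(nat \<Rightarrow> 'a) \<Rightarrow> real ^ 'n"
  assumes sh[measurable]: "shift \<in> measurable \<nu> \<nu>" and ph[measurable]: "\<phi> \<in> borel_measurable \<nu>"
    and rec: "joint_recurrent \<phi> \<nu>" and D[measurable]: "D \<in> sets \<nu>"
    and q: "0 < (q::real)" "\<And>x i. x \<in> space \<nu> \<Longrightarrow> q * \<phi> x $ i \<in> \<int>"
      "\<And>i. q * rotation_vector \<phi> \<nu> $ i \<in> \<int>"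
  shows "AE z in \<nu>. z \<in> D \<longrightarrow> infinite {L. (shift ^^ L) z \<in> D \<and>
    birkhoff_sum L \<phi> z = real L *\<^sub>R rotation_vector \<phi> \<nu>}"
proof -
  let ?r = "rotation_vector \<phi> \<nu>"
  define G where "G z = {L. (shift ^^ L) z \<in> D \<and> birkhoff_sum L \<phi> z = real L *\<^sub>R ?r}" for z
  \<comment> \<open>Points of \<open>(1/q) \<int>\<^sup>n\<close> of norm below \<open>1/q\<close> vanish.\<close>
  have exact: "birkhoff_sum L \<phi> z = real L *\<^sub>R ?r"
    if z: "z \<in> space \<nu>" and small: "norm (birkhoff_sum L \<phi> z - real L *\<^sub>R ?r) < 1 / q" for z L
  proof -
    let ?d = "birkhoff_sum L \<phi> z - real L *\<^sub>R ?r"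
    have orbit: "(shift ^^ j) z \<in> space \<nu>" for j
      using z by (induction j) (auto intro: measurable_space[OF sh])
    have "?d $ i = 0" for i
    proof -
      have "q * ?d $ i = (\<Sum>j<L. q * \<phi> ((shift ^^ j) z) $ i) - real L * (q * ?r $ i)"
        by (simp add: birkhoff_sum_def algebra_simps sum_distrib_left)
      also have "\<dots> \<in> \<int>" using q orbit by (intro Ints_diff Ints_sum Ints_mult[OF Ints_of_nat]) auto
      finally have "q * ?d $ i \<in> \<int>" .
      moreover have "\<bar>?d $ i\<bar> < 1 / q"
        using component_le_norm_cart[of ?d i] small by linarith
      then have "\<bar>q * ?d $ i\<bar> < 1"
        using q(1) by (simp only: abs_mult abs_of_pos pos_less_divide_eq mult.commute)
      ultimately have "q * ?d $ i = 0" using Ints_nonzero_abs_less1 by blast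
      then show ?thesis using q(1) by simp
    qed
    then show ?thesis by (simp add: vec_eq_iff)
  qed
  define E where "E M = {z \<in> space \<nu>. z \<in> D \<and> M \<in> G z \<and> (\<forall>L. M < L \<longrightarrow> L \<notin> G z)}" for M
  have [measurable]: "(\<lambda>x. (shift ^^ j) x) \<in> measurable \<nu> \<nu>" for j
    by (intro measurable_compose_n sh)
  have [measurable]: "birkhoff_sum L \<phi> \<in> borel_measurable \<nu>" for L
    unfolding birkhoff_sum_def by measurable
  have Esets: "E M \<in> sets \<nu>" for M unfolding E_def G_def by measurable
  have "joint_recurrence_set \<phi> \<nu> (E M) = {}" for M
  proof (rule ccontr)
    assume "joint_recurrence_set \<phi> \<nu> (E M) \<noteq> {}"
    then obtain z where z: "z \<in> E M" and returns: "\<forall>\<epsilon>>0. \<exists>L>0. (shift ^^ L) z \<in> E M \<and>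
        norm (birkhoff_sum L \<phi> z - real L *\<^sub>R ?r) < \<epsilon>"
      unfolding joint_recurrence_set_def by blast
    have "0 < 1 / q" using q(1) by simp
    from returns[rule_format, OF this] obtain L where L: "0 < L" "(shift ^^ L) z \<in> E M"
      "norm (birkhoff_sum L \<phi> z - real L *\<^sub>R ?r) < 1 / q" by blast
    have "birkhoff_sum L \<phi> z = real L *\<^sub>R ?r" 
      using z by (intro exact L(3)) (simp add: E_def)
    moreover have "M \<in> G ((shift ^^ L) z)" using L(2) by (simp add: E_def)
    moreover have "(shift ^^ (L + M)) z = (shift ^^ M) ((shift ^^ L) z)"
      by (metis add.commute comp_apply funpow_add)
    ultimately have "L + M \<in> G z"
      unfolding G_def by (auto simp: birkhoff_sum_add algebra_simps)
    then show False using z L(1) unfolding E_def by auto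
  qed
  then have "emeasure \<nu> (E M) = 0" for M
    using rec Esets[of M] unfolding joint_recurrent_def by (metis emeasure_empty)
  then have "AE z in \<nu>. z \<notin> E M" for M
    using Esets by (intro AE_not_in) (auto simp: null_sets_def)
  then have "AE z in \<nu>. \<forall>M. z \<notin> E M" by (simp add: AE_all_countable)
  then have "AE z in \<nu>. z \<in> D \<longrightarrow> infinite (G z)"
  proof (rule AE_mp, intro AE_I2 impI notI)
    fix z assume z: "z \<in> space \<nu>" "\<forall>M. z \<notin> E M" "z \<in> D" and fin: "finite (G z)"
    have "0 \<in> G z" using z by (simp add: G_def birkhoff_sum_def)
    then have "Max (G z) \<in> G z" using fin by (intro Max_in) auto
    moreover have "L \<notin> G z" if "Max (G z) < L" for L
      using that Max_ge[OF fin, of L] by (auto simp: not_le[symmetric])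
    ultimately have "z \<in> E (Max (G z))" using z by (simp add: E_def)
    then show False using z by blast
  qed
  then show ?thesis unfolding G_def .
qed

section \<open>Periodic points\<close>

lemma shift_in_subshift:
  assumes "subshift_of_finite_type X" "x \<in> X"
  shows "shift x \<in> X"
proof -
  obtain F where F: "X = {x. \<forall>w\<in>F. \<forall>i. map x [i..<i + length w] \<noteq> w}"
    using assms(1) unfolding subshift_of_finite_type_def by blast
  have window: "map (shift x) [i..<i + n] = map x [Suc i..<Suc i + n]" for i n
    by (rule nth_equalityI) (auto simp: shift_def simp del: upt_Suc)
  have "map (shift x) [i..<i + length w] \<noteq> w" if "w \<in> F" for w i
    using assms(2) that unfolding F window by blast
  then show ?thesis unfolding F by blast
qed

lemma periodic_extension_agrees:
  fixes z :: "nat \<Rightarrow> 'a"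
  assumes "0 < L" "\<forall>i<N. z (i + L) = z i" "i < N + L"
  shows "z (i mod L) = z i"
  using assms(3)
proof (induction i rule: less_induct)
  case (less i)
  show ?case
  proof (cases "i < L")
    case False
    then have "z ((i - L) mod L) = z (i - L)" using less assms(1) by auto
    moreover have "z i = z (i - L)" using False less.prems assms(2)[rule_format, of "i - L"] by auto
    ultimately show ?thesis using False by (simp add: le_mod_geq)
  qed simp
qed

text \<open>Once \<open>N\<close> is at least the length of every forbidden word, each such window of the periodic
  repetition starts, modulo \<open>L\<close>, at a position below \<open>L\<close>. There the repetition still coincides with
  \<open>z\<close>, so the window occurs in \<open>z\<close> and is admissible.\<close>

lemma subshift_closing:
  assumes "subshift_of_finite_type X"
  obtains N0 where "\<And>N z L. N0 \<le> N \<Longrightarrow> z \<in> X \<Longrightarrow> 0 < L \<Longrightarrow> \<forall>i<N. z (i + L) = z i \<Longrightarrow>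
    (\<lambda>i. z (i mod L)) \<in> X"
proof -
  obtain F where F: "finite F" "X = {x. \<forall>w\<in>F. \<forall>i. map x [i..<i + length w] \<noteq> w}"
    using assms unfolding subshift_of_finite_type_def by blast
  obtain N0 where N0: "\<And>w. w \<in> F \<Longrightarrow> length w \<le> N0"
    using finite_imageI[OF F(1), of length] finite_nat_set_iff_bounded_le by auto
  have "(\<lambda>i. z (i mod L)) \<in> X"
    if N: "N0 \<le> N" and z: "z \<in> X" "0 < L" "\<forall>i<N. z (i + L) = z i" for N z L
  proof -
    have "map (\<lambda>i. z (i mod L)) [i..<i + length w] = map z [i mod L..<i mod L + length w]"
      if w: "w \<in> F" for w i
    proof (rule nth_equalityI)
      fix t assume "t < length (map (\<lambda>i. z (i mod L)) [i..<i + length w])"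
      then have t: "t < length w" by simp
      have "z ((i mod L + t) mod L) = z (i mod L + t)"
        using t N N0[OF w] z(2) mod_less_divisor[OF z(2), of i]
        by (intro periodic_extension_agrees[OF z(2,3)]) linarith
      then show "map (\<lambda>i. z (i mod L)) [i..<i + length w] ! t =
          map z [i mod L..<i mod L + length w] ! t"
        using t by (simp add: mod_simps)
    qed simp
    then show ?thesis using z(1) unfolding F(2) by simp
  qed
  then show thesis by (rule that)
qed

text \<open>Realising the orbit average as a push-forward of the uniform distribution on \<open>{..<L}\<close> gives at once
  a probability measure whose integrals are finite sums.\<close>

definition orbit_measure ::
    "real \<Rightarrow> (nat \<Rightarrow> 'a) set \<Rightarrow> nat \<Rightarrow> (nat \<Rightarrow> 'a) \<Rightarrow> (nat \<Rightarrow> 'a) measure" where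
  "orbit_measure l X L x =
     distr (measure_pmf (pmf_of_set {..<L})) (shift_borel l X) (\<lambda>j. (shift ^^ j) x)"

lemma integral_orbit_measure:
  fixes f :: "(nat \<Rightarrow> 'a) \<Rightarrow> real"
  assumes "\<And>j. (shift ^^ j) x \<in> X" "0 < L" "f \<in> borel_measurable (shift_borel l X)"
  shows "integral\<^sup>L (orbit_measure l X L x) f = birkhoff_sum L f x / real L"
proof -
  have "{..<L} \<noteq> {}" using assms(2) by auto
  then show ?thesis
    unfolding orbit_measure_def using assms
    by (subst integral_distr) (auto simp: space_shift_borel integral_pmf_of_set birkhoff_sum_def)
qed

lemma emeasure_orbit_measure:
  assumes "\<And>j. (shift ^^ j) x \<in> X" "0 < L" "B \<in> sets (shift_borel l X)"
  shows "emeasure (orbit_measure l X L x) B = ennreal ((\<Sum>j<L. indicator B ((shift ^^ j) x)) / real L)"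
proof -
  have ne: "{..<L} \<noteq> {}" using assms(2) by auto
  have "emeasure (orbit_measure l X L x) B =
      emeasure (measure_pmf (pmf_of_set {..<L})) {j. (shift ^^ j) x \<in> B}"
    unfolding orbit_measure_def using assms
    by (subst emeasure_distr) (auto simp: space_shift_borel vimage_def)
  also have "\<dots> = ennreal (real (card ({..<L} \<inter> {j. (shift ^^ j) x \<in> B})) / real L)"
    using ne by (subst emeasure_pmf_of_set) (auto simp: measure_pmf.emeasure_eq_measure)
  also have "real (card ({..<L} \<inter> {j. (shift ^^ j) x \<in> B})) = (\<Sum>j<L. indicator B ((shift ^^ j) x))"
    by (simp add: indicator_def of_bool_def sum.If_cases)
  finally show ?thesis .
qed

lemma orbit_measure_periodic:
  assumes x: "\<And>j. (shift ^^ j) x \<in> X" "0 < L" "(shift ^^ L) x = x"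
  shows "periodic_measure l X (orbit_measure l X L x)"
proof -
  have "emeasure (orbit_measure l X L x) B = ennreal (1 / real L) *
      (\<Sum>j<L. emeasure (return (shift_borel l X) ((shift ^^ j) x)) B)"
    if "B \<in> sets (shift_borel l X)" for B
  proof -
    have "(\<Sum>j<L. emeasure (return (shift_borel l X) ((shift ^^ j) x)) B) =
        ennreal (\<Sum>j<L. indicator B ((shift ^^ j) x))"
      using that by (simp add: sum_nonneg flip: ennreal_indicator)
    moreover have "ennreal (1 / real L) * ennreal (\<Sum>j<L. indicator B ((shift ^^ j) x)) =
        ennreal ((\<Sum>j<L. indicator B ((shift ^^ j) x)) / real L)"
      by (subst ennreal_mult[symmetric]) (simp_all add: sum_nonneg)
    ultimately show ?thesis by (simp only: emeasure_orbit_measure[OF x(1,2) that])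
  qed
  moreover have "sets (orbit_measure l X L x) = sets (shift_borel l X)"
    by (simp add: orbit_measure_def)
  moreover have "x \<in> X" using x(1)[of 0] by simp
  ultimately show ?thesis unfolding periodic_measure_def using x by metis
qed

lemma orbit_measure_invariant:
  assumes l: "0 < l" "l < 1" and inv: "\<And>x. x \<in> X \<Longrightarrow> shift x \<in> X"
    and x: "x \<in> X" "0 < L" "(shift ^^ L) x = x"
  shows "orbit_measure l X L x \<in> invariant_measures l X"
proof -
  have orbit: "(shift ^^ j) x \<in> X" for j by (induction j) (auto simp: x inv)
  have "prob_space (orbit_measure l X L x)" unfolding orbit_measure_def
    by (intro measure_pmf.prob_space_distr) (auto simp: orbit space_shift_borel)
  moreover have "emeasure (orbit_measure l X L x) (shift -` B \<inter> X) = emeasure (orbit_measure l X L x) B"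
    if B: "B \<in> sets (shift_borel l X)" for B
  proof -
    have B': "shift -` B \<inter> X \<in> sets (shift_borel l X)"
      using measurable_sets[OF shift_measurable[OF l inv] B] by (simp add: space_shift_borel)
    have "(\<Sum>j<L. indicator (shift -` B \<inter> X) ((shift ^^ j) x)) =
        (\<Sum>j<L. indicator B ((shift ^^ Suc j) x) :: real)"
      using orbit by (intro sum.cong) (auto simp: indicator_def)
    \<comment> \<open>Shifting the index trades the term at \<open>0\<close> for the one at \<open>L\<close>, which is equal by periodicity.\<close>
    also have "\<dots> = (\<Sum>j<L. indicator B ((shift ^^ j) x))"
      using sum.lessThan_Suc_shift[of "\<lambda>j. indicator B ((shift ^^ j) x) :: real" L]
        sum.lessThan_Suc[of "\<lambda>j. indicator B ((shift ^^ j) x) :: real" L] x(3)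
      by simp
    finally show ?thesis
      by (simp add: emeasure_orbit_measure[OF orbit x(2)] B B')
  qed
  ultimately show ?thesis unfolding invariant_measures_def
    by (simp add: orbit_measure_def)
qed

section \<open>Approximation by periodic measures in a rational fiber\<close>

theorem theorem10:
  fixes l :: real
    and X :: "(nat \<Rightarrow> 'a::finite) set"
    and \<phi> :: "(nat \<Rightarrow> 'a) \<Rightarrow> real ^ 'n"
    and A :: "(nat \<Rightarrow> 'a) \<Rightarrow> real"
    and r :: "real ^ 'n"
    and \<nu> :: "(nat \<Rightarrow> 'a) measure"
  assumes "0 < l" and "l < 1"
    and "subshift_of_finite_type X"
    and "continuous_map (shift_topology l X) euclidean \<phi>"
    and "\<phi> ` X \<subseteq> rational_vectors"
    and "locally_constant X \<phi>"
    and "walters_function l X A"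
    and "r \<in> rotation_vector \<phi> ` invariant_measures l X \<inter> rational_vectors"
    and "\<nu> \<in> rotation_fiber l X \<phi> r"
    and "ergodic_measure l X \<nu>"
    and "joint_recurrent \<phi> \<nu>"
  shows "\<forall>\<epsilon>>0. \<exists>\<mu>\<in>rotation_fiber l X \<phi> r.
           periodic_measure l X \<mu> \<and> \<bar>integral\<^sup>L \<nu> A - integral\<^sup>L \<mu> A\<bar> < \<epsilon>"
proof (intro allI impI)
  fix \<epsilon> :: real assume "0 < \<epsilon>"
  note l = assms(1,2)
  let ?B = "shift_borel l X"
  have sets_nu: "sets \<nu> = sets ?B" and prob: "prob_space \<nu>"
    and inv: "\<And>B. B \<in> sets \<nu> \<Longrightarrow> emeasure \<nu> (shift -` B \<inter> X) = emeasure \<nu> B"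
    and erg: "\<And>B. B \<in> sets \<nu> \<Longrightarrow> shift -` B \<inter> X = B \<Longrightarrow> emeasure \<nu> B = 0 \<or> emeasure \<nu> B = 1"
    using assms(10) unfolding ergodic_measure_def invariant_measures_def by auto
  interpret prob_space \<nu> by (rule prob)
  have r: "rotation_vector \<phi> \<nu> = r" using assms(9) unfolding rotation_fiber_def by auto
  have space_nu: "space \<nu> = X" using sets_eq_imp_space_eq[OF sets_nu] by (simp add: space_shift_borel)
  note shX = shift_in_subshift[OF assms(3)]
  have sh: "shift \<in> measurable \<nu> \<nu>"
    using shift_measurable[OF l shX] by (simp add: measurable_cong_sets[OF sets_nu sets_nu])
  have phB: "\<phi> \<in> borel_measurable ?B" by (rule continuous_map_borel_measurable[OF l assms(4)])
  have AB: "A \<in> borel_measurable ?B"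
    using assms(7) continuous_map_borel_measurable[OF l] unfolding walters_function_def by blast
  have ph: "\<phi> \<in> borel_measurable \<nu>" and Am: "A \<in> borel_measurable \<nu>"
    using phB AB by (auto simp: measurable_cong_sets[OF sets_nu refl])
  obtain K where "\<forall>x\<in>X. \<bar>A x\<bar> \<le> K" using walters_function_bounded[OF l assms(7)] by blast
  then have A_int: "integrable \<nu> A"
    using Am by (intro integrable_const_bound[of _ K]) (auto simp: space_nu)

  obtain m where m: "\<And>x y. x \<in> X \<Longrightarrow> y \<in> X \<Longrightarrow> \<forall>i\<le>m. x i = y i \<Longrightarrow> \<phi> x = \<phi> y"
    using assms(6) unfolding locally_constant_def by blast
  have "finite (\<phi> ` X)" by (rule finite_range_of_prefix[where N = "Suc m"]) (auto intro: m)
  then have "finite ((\<lambda>(v, i). v $ i) ` (insert r (\<phi> ` X) \<times> UNIV))" (is "finite ?F") by auto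
  moreover have "?F \<subseteq> \<rat>" using assms(5,8) unfolding rational_vectors_def by auto
  ultimately obtain q :: nat where "q > 0" and q: "\<forall>x\<in>?F. real q * x \<in> \<int>"
    using common_denominator by blast

  obtain N1 where N1: "\<And>N k x y. N1 \<le> N \<Longrightarrow> 0 < k \<Longrightarrow> x \<in> X \<Longrightarrow> y \<in> X \<Longrightarrow> \<forall>i<N + k. x i = y i \<Longrightarrow>
      \<bar>birkhoff_sum k A x - birkhoff_sum k A y\<bar> < \<epsilon> / 3"
    by (rule walters_function_small[OF l assms(7), of "\<epsilon> / 3"]) (use \<open>0 < \<epsilon>\<close> in auto)
  obtain N2 where N2: "\<And>N z L. N2 \<le> N \<Longrightarrow> z \<in> X \<Longrightarrow> 0 < L \<Longrightarrow> \<forall>i<N. z (i + L) = z i \<Longrightarrow>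
      (\<lambda>i. z (i mod L)) \<in> X"
    by (rule subshift_closing[OF assms(3)]) (rule that, blast)
  \<comment> \<open>The cylinder length: \<open>N1\<close> controls \<open>A\<close>, \<open>N2\<close> controls the forbidden words and \<open>m\<close> the function
    \<open>\<phi>\<close>. For \<open>j < L\<close>, agreement on \<open>N + L\<close> symbols leaves at least \<open>m + 1\<close> common symbols after
    \<open>j\<close> shifts, as needed because \<open>\<phi>\<close> reads the coordinates \<open>0, \<dots>, m\<close>.\<close>
  define N where "N = N1 + N2 + m"
  \<comment> \<open>The words \<open>w\<close> are countably many, so almost every point has infinitely many exact returns to
    the cylinder that it lies in; the word need not be chosen in advance.\<close>
  define G where "G w z = {L. (shift ^^ L) z \<in> {x \<in> X. map x [0..<N] = w} \<and>
      birkhoff_sum L \<phi> z = real L *\<^sub>R r}" for w z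
  have "AE z in \<nu>. z \<in> {x \<in> X. map x [0..<N] = w} \<longrightarrow> infinite (G w z)" for w
    unfolding G_def r[symmetric] using \<open>q > 0\<close> q
    by (intro AE_infinitely_many_exact_returns[OF sh ph assms(11), where q = "real q"])
       (auto simp: space_nu sets_nu r intro!: cylinder_in_sets[OF l])
  then have "AE z in \<nu>. \<forall>w. z \<in> {x \<in> X. map x [0..<N] = w} \<longrightarrow> infinite (G w z)"
    unfolding AE_all_countable by blast
  moreover have "AE z in \<nu>. \<exists>C. \<forall>n. \<bar>birkhoff_sum n A z - real n * integral\<^sup>L \<nu> A\<bar> \<le> real n * (\<epsilon> / 3) + C"
    unfolding birkhoff_sum_def using inv erg \<open>0 < \<epsilon>\<close>
    by (intro AE_orbit_sums_linear[OF prob sh _ _ A_int]) (simp_all add: space_nu)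
  ultimately have "AE z in \<nu>. (\<forall>w. z \<in> {x \<in> X. map x [0..<N] = w} \<longrightarrow> infinite (G w z)) \<and>
      (\<exists>C. \<forall>n. \<bar>birkhoff_sum n A z - real n * integral\<^sup>L \<nu> A\<bar> \<le> real n * (\<epsilon> / 3) + C) \<and> z \<in> X"
    using AE_space[of \<nu>] unfolding space_nu by eventually_elim blast
  from eventually_happens'[OF ae_filter_bot this]
  obtain z where zX: "z \<in> X" and inf: "\<forall>w. z \<in> {x \<in> X. map x [0..<N] = w} \<longrightarrow> infinite (G w z)"
    and bd: "\<exists>C. \<forall>n. \<bar>birkhoff_sum n A z - real n * integral\<^sup>L \<nu> A\<bar> \<le> real n * (\<epsilon> / 3) + C"
    by blast
  have z: "z \<in> X" "infinite (G (map z [0..<N]) z)" using zX inf by simp_all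
  obtain C where C: "\<And>n. \<bar>birkhoff_sum n A z - real n * integral\<^sup>L \<nu> A\<bar> \<le> real n * (\<epsilon> / 3) + C"
    using bd by blast
  \<comment> \<open>A time beyond \<open>3 \<bar>C\<bar> / \<epsilon>\<close> absorbs the additive constant of the ergodic estimate.\<close>
  obtain n0 :: nat where n0: "3 * \<bar>C\<bar> / \<epsilon> \<le> real n0" using real_arch_simple by blast
  obtain L where L: "n0 < L" "L \<in> G (map z [0..<N]) z"
    using z(2) infinite_nat_iff_unbounded by blast
  have "0 < L" using L by auto
  have ret: "\<forall>i<N. z (i + L) = z i" and ex: "birkhoff_sum L \<phi> z = real L *\<^sub>R r"
    using L(2) unfolding G_def by (auto simp: funpow_shift)

  define x where "x = (\<lambda>i. z (i mod L))"
  have xX: "x \<in> X" unfolding x_def by (rule N2[OF _ z(1) \<open>0 < L\<close> ret]) (simp add: N_def)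
  have xz: "x i = z i" if "i < N + L" for i
    unfolding x_def by (rule periodic_extension_agrees[OF \<open>0 < L\<close> ret that])
  have per: "(shift ^^ L) x = x" by (simp add: funpow_shift x_def)
  have orbit: "(shift ^^ j) y \<in> X" if "y \<in> X" for j y using that by (induction j) (auto intro: shX)
  have "\<phi> ((shift ^^ j) x) = \<phi> ((shift ^^ j) z)" if "j < L" for j
    using that by (intro m orbit xX z(1)) (auto simp: funpow_shift N_def intro!: xz)
  then have "birkhoff_sum L \<phi> x = birkhoff_sum L \<phi> z" by (simp add: birkhoff_sum_def)
  then have phi_x: "birkhoff_sum L \<phi> x = real L *\<^sub>R r" using ex by simp

  let ?\<mu> = "orbit_measure l X L x"
  have "rotation_vector \<phi> ?\<mu> = r"
  proof -
    have "integral\<^sup>L ?\<mu> (\<lambda>y. \<phi> y $ i) = r $ i" for i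
    proof -
      have "continuous_on UNIV (\<lambda>v :: real ^ 'n. v $ i)" by (intro continuous_intros)
      then have comp: "(\<lambda>y. \<phi> y $ i) \<in> borel_measurable ?B"
        by (rule borel_measurable_continuous_on[OF _ phB])
      have "integral\<^sup>L ?\<mu> (\<lambda>y. \<phi> y $ i) = birkhoff_sum L \<phi> x $ i / real L"
        by (subst integral_orbit_measure[OF orbit[OF xX] \<open>0 < L\<close> comp])
          (simp add: birkhoff_sum_def)
      then show ?thesis using phi_x \<open>0 < L\<close> by simp
    qed
    then show ?thesis by (simp add: rotation_vector_def vec_eq_iff)
  qed
  then have fiber: "?\<mu> \<in> rotation_fiber l X \<phi> r"
    using orbit_measure_invariant[OF l shX xX \<open>0 < L\<close> per] by (simp add: rotation_fiber_def)
  have pm: "periodic_measure l X ?\<mu>" by (rule orbit_measure_periodic[OF orbit[OF xX] \<open>0 < L\<close> per])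
  have "\<bar>integral\<^sup>L \<nu> A - integral\<^sup>L ?\<mu> A\<bar> < \<epsilon>"
  proof -
    have I: "real L * integral\<^sup>L ?\<mu> A = birkhoff_sum L A x"
      using integral_orbit_measure[OF orbit[OF xX] \<open>0 < L\<close> AB] \<open>0 < L\<close> by simp
    \<comment> \<open>One third of \<open>L \<epsilon>\<close> each for closing the orbit, for \<open>C\<close>, and for the linear term at \<open>z\<close>.\<close>
    have "\<bar>birkhoff_sum L A x - birkhoff_sum L A z\<bar> < \<epsilon> / 3"
      by (rule N1[of N]) (auto simp: N_def[symmetric] xX z \<open>0 < L\<close> xz, simp add: N_def)
    moreover have "\<epsilon> / 3 \<le> real L * (\<epsilon> / 3)" using \<open>0 < L\<close> \<open>0 < \<epsilon>\<close> by simp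
    moreover have "C < real L * (\<epsilon> / 3)"
    proof -
      have "3 * \<bar>C\<bar> / \<epsilon> < real L" using n0 L(1) by simp
      then show ?thesis using \<open>0 < \<epsilon>\<close> by (simp add: field_simps)
    qed
    ultimately have "\<bar>real L * integral\<^sup>L \<nu> A - real L * integral\<^sup>L ?\<mu> A\<bar> < real L * \<epsilon>"
      using C[of L] unfolding I by linarith
    then have "real L * \<bar>integral\<^sup>L \<nu> A - integral\<^sup>L ?\<mu> A\<bar> < real L * \<epsilon>"
      by (simp add: abs_mult flip: right_diff_distrib)
    then show ?thesis using \<open>0 < L\<close> by simp
  qed
  then show "\<exists>\<mu>\<in>rotation_fiber l X \<phi> r. periodic_measure l X \<mu> \<and> \<bar>integral\<^sup>L \<nu> A - integral\<^sup>L \<mu> A\<bar> < \<epsilon>"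
    using fiber pm by blast
qed

end
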